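(* Let $\mathbf{H}$ be an algebraic torus defined over $\mathbb{Q}$, let $L$ be its splitting field, let $\mathcal{O}$ be the ring of integers of $L$ and $\mathcal{P}$ the set of nonzero prime ideals of $\mathcal{O}$. Let $n>0$ be an integer and let $S\subset\mathcal{P}$ be the set of prime ideals $\pi\in\mathcal{P}$ dividing $n$ (i.e. $n\in\pi$). Then there exists $h\in\mathbf{H}(\mathbb{Q})$ such that (i) $\chi(h)$ is not an algebraic integer for any non-trivial character $\chi\in X(\mathbf{H})$, and (ii) $\chi(h)\equiv 1 \mod n\mathcal{O}_\pi$ for any $\chi\in X(\mathbf{H})$ and any $\pi\in S$.
   Context: $X(\mathbf{H})$ denotes the group of characters of $\mathbf{H}$ (defined over $\overline{\mathbb{Q}}$), a $\mathrm{Gal}(\overline{\mathbb{Q}}/\mathbb{Q})$-module isomorphic to $\mathbb{Z}^{\dim \mathbf{H}}$. The splitting field of $\mathbf{H}$ is the smallest Galois extension $L$ of $\mathbb{Q}$ such that $\mathrm{Gal}(\overline{\mathbb{Q}}/L)$ acts trivially on $X(\mathbf{H})$; for $h\in\mathbf{H}(\mathbb{Q})$ and $\chi\in X(\mathbf{H})$ one has $\chi(h)\in L^*$. For $\pi\in\mathcal{P}$, $\mathcal{O}_\pi$ and $L_\pi$ are the $\pi$-adic completions of $\mathcal{O}$ and $L$; for $x,y\in L$, "$x\equiv y \mod n\mathcal{O}_\pi$" means that the images $x_\pi,y_\pi$ of $x,y$ in $L_\pi$ satisfy $x_\pi-y_\pi\in n\mathcal{O}_\pi$. *)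

theory Defs
  imports "HOL-Analysis.Analysis" "HOL-Computational_Algebra.Polynomial"
begin

text \<open>Number fields are modelled as subfields of the complex numbers.\<close>

definition is_subfield :: "complex set \<Rightarrow> bool" where
  "is_subfield L \<longleftrightarrow> 0 \<in> L \<and> 1 \<in> L \<and>
     (\<forall>x\<in>L. \<forall>y\<in>L. x + y \<in> L \<and> x * y \<in> L) \<and>
     (\<forall>x\<in>L. - x \<in> L \<and> inverse x \<in> L)"

definition ring_hom_on :: "complex set \<Rightarrow> (complex \<Rightarrow> complex) \<Rightarrow> bool" where
  "ring_hom_on L \<sigma> \<longleftrightarrow> \<sigma> 1 = 1 \<and>
     (\<forall>x\<in>L. \<forall>y\<in>L. \<sigma> (x + y) = \<sigma> x + \<sigma> y \<and> \<sigma> (x * y) = \<sigma> x * \<sigma> y)"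

text \<open>Finite Galois (= finite normal, characteristic 0) extension of \<open>\<rat>\<close> inside \<open>\<complex>\<close>:
  finite-dimensional over \<open>\<rat>\<close>, and every embedding into \<open>\<complex>\<close> maps it into itself.\<close>
definition finite_galois_ext :: "complex set \<Rightarrow> bool" where
  "finite_galois_ext L \<longleftrightarrow> is_subfield L \<and>
     (\<exists>B. finite B \<and> B \<subseteq> L \<and> (\<forall>x\<in>L. \<exists>c. x = (\<Sum>b\<in>B. of_rat (c b) * b))) \<and>
     (\<forall>\<sigma>. ring_hom_on L \<sigma> \<longrightarrow> \<sigma> ` L \<subseteq> L)"

definition gal :: "complex set \<Rightarrow> (complex \<Rightarrow> complex) set" where
  "gal L = {\<sigma>. bij_betw \<sigma> L L \<and> ring_hom_on L \<sigma> \<and> (\<forall>x. x \<notin> L \<longrightarrow> \<sigma> x = x)}"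

text \<open>A torus over \<open>\<rat>\<close> with splitting field L is given by its character module
  X(H) = Z^d with a faithful action of Gal(L/Q) by group automorphisms.\<close>
definition torus_action :: "complex set \<Rightarrow> ((complex \<Rightarrow> complex) \<Rightarrow> int ^ 'd \<Rightarrow> int ^ 'd) \<Rightarrow> bool" where
  "torus_action L act \<longleftrightarrow>
     (\<forall>\<sigma>\<in>gal L. \<forall>a b. act \<sigma> (a + b) = act \<sigma> a + act \<sigma> b) \<and>
     act id = id \<and>
     (\<forall>\<sigma>\<in>gal L. \<forall>\<tau>\<in>gal L. act (\<sigma> \<circ> \<tau>) = act \<sigma> \<circ> act \<tau>)"

text \<open>Faithfulness: L is exactly the splitting field (Gal(Qbar/L) is the kernel of the action).\<close>
definition faithful_action :: "complex set \<Rightarrow> ((complex \<Rightarrow> complex) \<Rightarrow> int ^ 'd \<Rightarrow> int ^ 'd) \<Rightarrow> bool" where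
  "faithful_action L act \<longleftrightarrow> (\<forall>\<sigma>\<in>gal L. act \<sigma> = id \<longrightarrow> \<sigma> = id)"

text \<open>Rational points H(Q) = Galois-equivariant homomorphisms X(H) \<rightarrow> L^*;
  for such an h and a character ch, ch(h) = h ch.\<close>
definition rational_point :: "complex set \<Rightarrow> ((complex \<Rightarrow> complex) \<Rightarrow> int ^ 'd \<Rightarrow> int ^ 'd)
     \<Rightarrow> (int ^ 'd \<Rightarrow> complex) \<Rightarrow> bool" where
  "rational_point L act h \<longleftrightarrow>
     (\<forall>ch. h ch \<in> L \<and> h ch \<noteq> 0) \<and>
     (\<forall>a b. h (a + b) = h a * h b) \<and>
     (\<forall>\<sigma>\<in>gal L. \<forall>ch. h (act \<sigma> ch) = \<sigma> (h ch))"

definition alg_int :: "complex \<Rightarrow> bool" where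
  "alg_int x \<longleftrightarrow> (\<exists>p :: int poly. lead_coeff p = 1 \<and> poly (map_poly of_int p) x = 0)"

definition ring_of_integers :: "complex set \<Rightarrow> complex set" where
  "ring_of_integers L = {x \<in> L. alg_int x}"

definition nonzero_prime_ideal :: "complex set \<Rightarrow> complex set \<Rightarrow> bool" where
  "nonzero_prime_ideal L \<pi> \<longleftrightarrow>
     (let OL = ring_of_integers L in
       \<pi> \<subseteq> OL \<and> 0 \<in> \<pi> \<and> (\<forall>x\<in>\<pi>. \<forall>y\<in>\<pi>. x + y \<in> \<pi>) \<and>
       (\<forall>a\<in>OL. \<forall>x\<in>\<pi>. a * x \<in> \<pi>) \<and>
       \<pi> \<noteq> {0} \<and> \<pi> \<noteq> OL \<and>
       (\<forall>a\<in>OL. \<forall>b\<in>OL. a * b \<in> \<pi> \<longrightarrow> a \<in> \<pi> \<or> b \<in> \<pi>))"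

text \<open>\<open>L \<inter> \<O>\<^sub>\<pi>\<close>, i.e. the localisation of \<open>\<O>\<close> at \<pi>.\<close>
definition local_integers :: "complex set \<Rightarrow> complex set \<Rightarrow> complex set" where
  "local_integers L \<pi> = {a / b | a b. a \<in> ring_of_integers L \<and> b \<in> ring_of_integers L \<and> b \<notin> \<pi>}"

definition cong_mod_local :: "complex set \<Rightarrow> complex set \<Rightarrow> nat \<Rightarrow> complex \<Rightarrow> complex \<Rightarrow> bool" where
  "cong_mod_local L \<pi> n x y \<longleftrightarrow> (x - y) / of_nat n \<in> local_integers L \<pi>"

end

theory Submission
  imports Defs "Jordan_Normal_Form.Char_Poly"
begin

text \<open>
  Neither valuations, class groups nor Chebotarev's theorem are needed. Take an integral \<open>\<theta>\<close> in \<open>L\<close>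
  with trivial stabiliser in the Galois group and with a monic integral minimal polynomial \<open>p\<close>, and let
  \<open>P\<close> be the reciprocal polynomial of \<open>p\<close>, so that \<open>P(s)\<close> is the norm of \<open>1 - s\<theta>\<close>. If an integer \<open>s\<close>
  is divisible by \<open>n\<close> and by all differences \<open>\<theta> - \<sigma>\<theta>\<close>, and \<open>P(s)\<close> is not a unit, then
  \<open>a = 1 - s\<theta>\<close> is congruent to \<open>1\<close> modulo \<open>n\<close>, is not a unit, and is comaximal to its other conjugates.
  Elements \<open>a\<close> and \<open>a'\<close> belonging to \<open>s\<close> and \<open>s'\<close> have comaximal conjugates as soon as \<open>P(s)\<close> divides \<open>s'\<close>.
  Choose one such \<open>a\<^sub>\<lambda>\<close> for each \<open>\<lambda>\<close> among the coordinate forms of \<open>X(H)\<close> and their negatives, and put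
  \<open>h(\<chi>) = \<Prod>\<^sub>\<lambda> \<Prod>\<^sub>\<sigma> \<sigma>(a\<^sub>\<lambda>) ^ \<lambda>(\<sigma>\<^sup>-\<^sup>1\<chi>)\<close>. For \<open>\<chi> \<noteq> 0\<close> some \<open>\<lambda>(\<chi>)\<close> is negative; were \<open>h(\<chi>)\<close> integral,
  \<open>a\<^sub>\<lambda>\<close> would divide a product of elements comaximal to it and hence be a unit.
\<close>

section \<open>Algebraic integers\<close>

interpretation zmod: Modules.module "\<lambda>(c::int) (x::complex). of_int c * x"
  by unfold_locales (simp_all add: algebra_simps)

text \<open>Multiplication by \<open>z\<close> acts on the generators \<open>S\<close> through an
  integer matrix that has the nonzero vector of generators as eigenvector, so \<open>z\<close> is a
  root of its monic characteristic polynomial. The generators may be linearly dependent.\<close>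

lemma alg_intI_stable_span:
  assumes fin: "finite S" and s0: "s0 \<in> S" "s0 \<noteq> 0"
    and stable: "\<And>s. s \<in> S \<Longrightarrow> z * s \<in> zmod.span S"
  shows "alg_int z"
proof -
  define N where "N = card S"
  obtain f where f: "bij_betw f {0..<N} S"
    using fin N_def ex_bij_betw_nat_finite by blast
  have fS: "f i \<in> S" if "i < N" for i
    using f that by (auto simp: bij_betw_def)
  have "\<exists>c. z * s = (\<Sum>t\<in>S. of_int (c t) * t)" if "s \<in> S" for s
    using stable[OF that] unfolding zmod.span_finite[OF fin] by auto
  then obtain c where c: "\<And>s. s \<in> S \<Longrightarrow> z * s = (\<Sum>t\<in>S. of_int (c s t) * t)"
    by metis
  define A :: "int mat" where "A = mat N N (\<lambda>(i, j). c (f i) (f j))"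
  define v :: "complex Matrix.vec" where "v = Matrix.vec N f"
  have A: "A \<in> carrier_mat N N" by (simp add: A_def)
  let ?A = "map_mat of_int A :: complex mat"
  have A': "?A \<in> carrier_mat N N" using A by simp
  have Av: "?A *\<^sub>v v = z \<cdot>\<^sub>v v"
  proof (rule eq_vecI)
    fix i assume "i < dim_vec (z \<cdot>\<^sub>v v)"
    then have i: "i < N" by (simp add: v_def)
    have "vec_index (?A *\<^sub>v v) i = (\<Sum>j = 0..<N. of_int (c (f i) (f j)) * f j)"
      using i by (simp add: A_def v_def scalar_prod_def)
    also have "\<dots> = (\<Sum>t\<in>S. of_int (c (f i) t) * t)"
      using sum.reindex_bij_betw[OF f, of "\<lambda>t. of_int (c (f i) t) * t"] by simp
    also have "\<dots> = z * f i" using c[OF fS[OF i]] by simp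
    finally show "vec_index (?A *\<^sub>v v) i = vec_index (z \<cdot>\<^sub>v v) i"
      using i by (simp add: v_def)
  qed (simp add: A_def v_def)
  obtain k where k: "k < N" "f k = s0"
    using f s0 by (auto simp: bij_betw_def)
  then have "v \<noteq> 0\<^sub>v N"
    using s0 by (metis v_def index_vec index_zero_vec(1))
  then have "eigenvalue ?A z"
    unfolding eigenvalue_def eigenvector_def using Av A' by (intro exI[of _ v]) (auto simp: v_def)
  then have "poly (char_poly ?A) z = 0"
    using eigenvalue_root_char_poly[OF A'] by simp
  then have "poly (map_poly of_int (char_poly A)) z = 0"
    using of_int_hom.char_poly_hom[OF A, where 'a = complex] by simp
  moreover have "lead_coeff (char_poly A) = 1"
    using degree_monic_char_poly[OF A] by simp
  ultimately show ?thesis unfolding alg_int_def by blast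
qed

lemma span_mult_closed:
  assumes s: "s \<in> zmod.span A" and "\<And>a. a \<in> A \<Longrightarrow> t * a \<in> zmod.span B"
  shows "t * s \<in> zmod.span B"
  using s
proof (induct rule: zmod.span_induct_alt)
  case base
  then show ?case by (simp add: zmod.span_zero)
next
  case (step c x y)
  have "t * (of_int c * x + y) = of_int c * (t * x) + t * y" by (simp add: algebra_simps)
  then show ?case using step assms(2) by (simp add: zmod.span_add zmod.span_scale)
qed

text \<open>The monic equation expresses the top power through the lower ones. Positivity of
  \<open>m\<close> puts 1 among the generators.\<close>

lemma alg_int_power_in_span:
  assumes "alg_int x"
  shows "\<exists>m>0. x ^ m \<in> zmod.span ((\<lambda>i. x ^ i) ` {..<m})"
proof -
  obtain p :: "int poly" where p: "lead_coeff p = 1" "poly (map_poly of_int p) x = 0"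
    using assms unfolding alg_int_def by blast
  let ?V = "zmod.span ((\<lambda>i. x ^ i) ` {..<degree p})"
  have deg: "degree p > 0"
  proof (rule ccontr)
    assume "\<not> degree p > 0"
    then have "p = 1" using p(1) by (metis gr0I degree_eq_zeroE coeff_pCons_0 one_pCons)
    then show False using p(2) by simp
  qed
  have "0 = (\<Sum>i\<le>degree p. of_int (coeff p i) * x ^ i)"
    using p(2) by (simp add: poly_altdef degree_map_poly coeff_map_poly)
  also have "\<dots> = (\<Sum>i<degree p. of_int (coeff p i) * x ^ i) + x ^ degree p"
    using p(1) by (simp add: lessThan_Suc_atMost[symmetric])
  finally have "x ^ degree p = - (\<Sum>i<degree p. of_int (coeff p i) * x ^ i)"
    by (simp add: eq_neg_iff_add_eq_0 add.commute)
  also have "\<dots> \<in> ?V"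
    by (intro zmod.span_neg zmod.span_sum zmod.span_scale zmod.span_base) auto
  finally show ?thesis using deg by blast
qed

text \<open>The span of the monomials \<open>x ^ i * y ^ j\<close> with \<open>i < m\<close> and
  \<open>j < n\<close> is stable under both \<open>x\<close> and \<open>y\<close>, hence under their
  sum and product.\<close>

lemma
  assumes "alg_int x" "alg_int y"
  shows alg_int_add: "alg_int (x + y)" and alg_int_mult: "alg_int (x * y)"
proof -
  obtain m where m: "m > 0" "x ^ m \<in> zmod.span ((\<lambda>i. x ^ i) ` {..<m})"
    using alg_int_power_in_span[OF assms(1)] by blast
  obtain n where n: "n > 0" "y ^ n \<in> zmod.span ((\<lambda>i. y ^ i) ` {..<n})"
    using alg_int_power_in_span[OF assms(2)] by blast
  define S where "S = (\<lambda>(i, j). x ^ i * y ^ j) ` ({..<m} \<times> {..<n})"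
  have S: "x ^ i * y ^ j \<in> zmod.span S" if "i < m" "j < n" for i j
    using that by (intro zmod.span_base) (auto simp: S_def)
  have x: "x * s \<in> zmod.span S" if sS: "s \<in> S" for s
  proof -
    obtain i j where ij: "s = x ^ i * y ^ j" "i < m" "j < n" using sS by (auto simp: S_def)
    have "x ^ Suc i \<in> zmod.span ((\<lambda>i. x ^ i) ` {..<m})"
    proof (cases "Suc i = m")
      case False
      then show ?thesis using ij by (intro zmod.span_base image_eqI[of _ _ "Suc i"]) auto
    qed (use m in simp)
    then have "y ^ j * x ^ Suc i \<in> zmod.span S"
      by (rule span_mult_closed) (use S ij in \<open>auto simp: mult.commute\<close>)
    then show ?thesis using ij by (simp add: mult_ac)
  qed
  have y: "y * s \<in> zmod.span S" if sS: "s \<in> S" for s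
  proof -
    obtain i j where ij: "s = x ^ i * y ^ j" "i < m" "j < n" using sS by (auto simp: S_def)
    have "y ^ Suc j \<in> zmod.span ((\<lambda>i. y ^ i) ` {..<n})"
    proof (cases "Suc j = n")
      case False
      then show ?thesis using ij by (intro zmod.span_base image_eqI[of _ _ "Suc j"]) auto
    qed (use n in simp)
    then have "x ^ i * y ^ Suc j \<in> zmod.span S"
      by (rule span_mult_closed) (use S ij in auto)
    then show ?thesis using ij by (simp add: mult_ac)
  qed
  have fin: "finite S" by (simp add: S_def)
  have one: "1 \<in> S" unfolding S_def using m n by (intro image_eqI[of _ _ "(0, 0)"]) auto
  show "alg_int (x + y)"
    by (rule alg_intI_stable_span[OF fin one])
      (auto simp: distrib_right intro!: zmod.span_add x y)
  show "alg_int (x * y)"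
  proof (rule alg_intI_stable_span[OF fin one])
    fix s assume "s \<in> S"
    then have "x * (y * s) \<in> zmod.span S" by (intro span_mult_closed[OF y x])
    then show "x * y * s \<in> zmod.span S" by (simp add: mult.assoc)
  qed simp
qed

lemma alg_int_of_int [simp]: "alg_int (of_int k)"
  unfolding alg_int_def by (intro exI[of _ "[:-k, 1:]"]) (simp add: map_poly_pCons)

text \<open>Multiplying the integral relation of \<open>1 / u\<close> by \<open>u ^ (m - 1)\<close>
  turns it into an expression of \<open>1 / u\<close> by nonnegative powers of
  \<open>u\<close>.\<close>

lemma inverse_unit_in_poly:
  assumes u: "u \<noteq> 0" and w: "alg_int (1 / u)"
  shows "\<exists>g :: int poly. 1 / u = poly (map_poly of_int g) u"
proof -
  obtain m where m: "m > 0" "(1 / u) ^ m \<in> zmod.span ((\<lambda>i. (1 / u) ^ i) ` {..<m})"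
    using alg_int_power_in_span[OF w] by blast
  then obtain k where k: "m = Suc k" using gr0_implies_Suc by blast
  have "u ^ k * (1 / u) ^ m \<in> zmod.span ((\<lambda>i. u ^ i) ` UNIV)"
  proof (rule span_mult_closed[OF m(2)])
    fix a assume "a \<in> (\<lambda>i. (1 / u) ^ i) ` {..<m}"
    then obtain i where i: "a = (1 / u) ^ i" "i \<le> k" using k by auto
    have "u ^ k * a = u ^ (k - i)"
      using i u by (simp add: power_diff power_divide)
    then show "u ^ k * a \<in> zmod.span ((\<lambda>i. u ^ i) ` UNIV)"
      by (auto intro: zmod.span_base)
  qed
  moreover have "u ^ k * (1 / u) ^ m = 1 / u"
    using u k by (simp add: power_divide)
  ultimately have "1 / u \<in> zmod.span ((\<lambda>i. u ^ i) ` UNIV)" by simp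
  then show ?thesis
  proof (induct rule: zmod.span_induct_alt)
    case base
    show ?case by (intro exI[of _ 0]) simp
  next
    case (step c x y)
    then obtain i g where "x = u ^ i" "y = poly (map_poly of_int g) u" by auto
    then have "of_int c * x + y = poly (map_poly of_int (monom c i + g)) u"
      by (simp add: of_int_poly_hom.hom_add poly_monom)
    then show ?case by blast
  qed
qed

lemma alg_int_0 [simp]: "alg_int 0" and alg_int_1 [simp]: "alg_int 1"
  and alg_int_of_nat [simp]: "alg_int (of_nat k)"
  using alg_int_of_int[of 0] alg_int_of_int[of 1] alg_int_of_int[of "int k"] by simp_all

lemma alg_int_uminus: "alg_int x \<Longrightarrow> alg_int (- x)"
  using alg_int_mult[OF alg_int_of_int[of "-1"], of x] by simp

lemma alg_int_diff: "alg_int x \<Longrightarrow> alg_int y \<Longrightarrow> alg_int (x - y)"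
  using alg_int_add[of x "- y"] alg_int_uminus[of y] by simp

lemma alg_int_power: "alg_int x \<Longrightarrow> alg_int (x ^ k)"
  by (induct k) (auto intro: alg_int_mult)

lemma alg_int_sum: "(\<And>i. i \<in> I \<Longrightarrow> alg_int (f i)) \<Longrightarrow> alg_int (sum f I)"
  by (induct I rule: infinite_finite_induct) (auto intro: alg_int_add)

lemma alg_int_prod: "(\<And>i. i \<in> I \<Longrightarrow> alg_int (f i)) \<Longrightarrow> alg_int (prod f I)"
  by (induct I rule: infinite_finite_induct) (auto intro: alg_int_mult)

lemmas alg_int_intros = alg_int_add alg_int_diff alg_int_uminus alg_int_mult alg_int_power
  alg_int_sum alg_int_prod alg_int_of_int alg_int_of_nat alg_int_0 alg_int_1

section \<open>Integer polynomials of least degree at an algebraic number\<close>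

lemma dvd_of_monic_minimal_degree:
  fixes p :: "int poly" and x :: complex
  assumes monic: "lead_coeff p = 1"
    and root: "poly (map_poly of_int p) x = 0"
    and min: "\<And>g :: int poly. poly (map_poly of_int g) x = 0 \<Longrightarrow> g \<noteq> 0 \<Longrightarrow> degree p \<le> degree g"
    and g: "poly (map_poly of_int g) x = 0"
  shows "p dvd g"
proof -
  have p0: "p \<noteq> 0" using monic by auto
  \<comment> \<open>Pseudo-division scales \<open>g\<close> by a power of the leading coefficient of
    \<open>p\<close>, which is 1, so it is genuine division over the integers.\<close>
  obtain q r where qr: "pseudo_divmod g p = (q, r)" by force
  then have eq: "g = p * q + r" and deg: "r = 0 \<or> degree r < degree p"
    using pseudo_divmod[OF p0, of g q r] monic by simp_all
  have "poly (map_poly of_int r) x = 0"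
    using g root unfolding eq by (simp add: of_int_poly_hom.hom_add of_int_poly_hom.hom_mult)
  then have "r = 0" using min[of r] deg by linarith
  then show ?thesis using eq by simp
qed

text \<open>Multiplying an algebraic number by the leading coefficient of an integer polynomial of least
  degree makes that polynomial monic, which avoids any appeal to Gauss's lemma.\<close>

lemma exists_minimal_monic_multiple:
  fixes x :: complex
  assumes "alg_int x"
  obtains r :: int and p :: "int poly" where "r \<noteq> 0" "lead_coeff p = 1" "degree p > 0"
    "poly (map_poly of_int p) (of_int r * x) = 0"
    "\<And>g :: int poly. poly (map_poly of_int g) (of_int r * x) = 0 \<Longrightarrow> p dvd g"
proof -
  let ?Q = "\<lambda>q :: int poly. q \<noteq> 0 \<and> poly (map_poly of_int q) x = 0"
  obtain p0 where "?Q p0" using assms unfolding alg_int_def by (metis leading_coeff_0_iff zero_neq_one)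
  then obtain q where q: "?Q q" and min: "\<And>g. ?Q g \<Longrightarrow> degree q \<le> degree g"
    using ex_has_least_nat[of ?Q p0 degree] by blast
  define k r where "k = degree q" and "r = lead_coeff q"
  have r: "r \<noteq> 0" using q by (simp add: r_def)
  have k: "k > 0"
  proof (rule ccontr)
    assume "\<not> k > 0"
    then obtain c where "q = [:c:]" by (metis k_def degree_eq_zeroE gr0I)
    then show False using q by (auto simp: map_poly_pCons)
  qed
  \<comment> \<open>The scaling is chosen so that \<open>p(r X) = r ^ (k - 1) * q(X)\<close>, where
    the leading coefficient \<open>r\<close> of \<open>q\<close> completes the factor
    \<open>r ^ k\<close>.\<close>
  define s where "s = (\<Sum>i<k. monom (coeff q i * r ^ (k - 1 - i)) i)"
  define p where "p = s + monom 1 k"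
  have ds: "degree s < k"
    unfolding s_def by (intro degree_sum_less k) (metis degree_monom_le lessThan_iff order.strict_trans1)
  have dp: "degree p = k" "lead_coeff p = 1"
    using ds unfolding p_def by (simp_all add: degree_add_eq_right degree_monom_eq coeff_eq_0)
  have "poly (map_poly of_int p) (of_int r * x)
      = (\<Sum>i<k. of_int (coeff q i * r ^ (k - 1 - i)) * (of_int r * x) ^ i) + (of_int r * x) ^ k"
    unfolding p_def s_def
    by (simp add: of_int_poly_hom.hom_add of_int_poly_hom.hom_sum poly_sum poly_monom)
  also have "(\<Sum>i<k. of_int (coeff q i * r ^ (k - 1 - i)) * (of_int r * x) ^ i)
      = (\<Sum>i<k. of_int r ^ (k - 1) * (of_int (coeff q i) * x ^ i))"
  proof (intro sum.cong refl)
    fix i assume "i \<in> {..<k}"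
    then have "k - 1 = (k - 1 - i) + i" by simp
    then have "(of_int r :: complex) ^ (k - 1) = of_int r ^ (k - 1 - i) * of_int r ^ i"
      by (metis power_add)
    then show "of_int (coeff q i * r ^ (k - 1 - i)) * (of_int r * x) ^ i
        = of_int r ^ (k - 1) * (of_int (coeff q i) * x ^ i)"
      by (simp add: power_mult_distrib)
  qed
  also have "\<dots> + (of_int r * x) ^ k
      = of_int r ^ (k - 1) * ((\<Sum>i<k. of_int (coeff q i) * x ^ i) + of_int r * x ^ k)"
    using power_minus_mult[OF k, of "of_int r :: complex"]
    by (simp add: power_mult_distrib sum_distrib_left distrib_left mult.assoc[symmetric])
  also have "(\<Sum>i<k. of_int (coeff q i) * x ^ i) + of_int r * x ^ k = poly (map_poly of_int q) x"
    by (simp add: poly_altdef degree_map_poly coeff_map_poly r_def k_def lessThan_Suc_atMost[symmetric])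
  finally have root: "poly (map_poly of_int p) (of_int r * x) = 0" using q by simp
  have "degree p \<le> degree g" if g: "poly (map_poly of_int g) (of_int r * x) = 0" "g \<noteq> 0" for g :: "int poly"
  proof -
    \<comment> \<open>Substituting \<open>r X\<close> preserves the degree and moves a zero at
      \<open>r x\<close> to one at \<open>x\<close>, so minimality of \<open>q\<close> passes to
      \<open>p\<close>.\<close>
    have "poly (map_poly of_int (pcompose g [:0, r:])) x = 0"
      using g r by (simp add: of_int_hom.map_poly_pcompose poly_pcompose map_poly_pCons mult.commute)
    moreover have "pcompose g [:0, r:] \<noteq> 0" using g r by (simp add: pcompose_eq_0_iff)
    ultimately have "degree q \<le> degree (pcompose g [:0, r:])" using min by blast
    then show ?thesis using r dp by (simp add: degree_pcompose k_def)
  qed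
  then have "p dvd g" if "poly (map_poly of_int g) (of_int r * x) = 0" for g :: "int poly"
    using dvd_of_monic_minimal_degree[OF dp(2) root _ that] by blast
  then show ?thesis using that r dp root k by blast
qed

section \<open>Reciprocal polynomials and the elements \<open>1 - s \<theta>\<close>\<close>

lemma of_int_poly_reflect_poly:
  fixes p :: "int poly" and s :: int
  assumes "s \<noteq> 0"
  shows "(of_int (poly (reflect_poly p) s) :: 'a :: field_char_0)
    = of_int s ^ degree p * poly (map_poly of_int p) (inverse (of_int s))"
proof -
  have "map_poly of_int (reflect_poly p) = reflect_poly (map_poly of_int p :: 'a poly)"
    by (rule poly_eqI) (simp add: coeff_map_poly coeff_reflect_poly degree_map_poly)
  then show ?thesis
    using assms poly_reflect_poly_nz[of "of_int s :: 'a" "map_poly of_int p"]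
    by (simp flip: of_int_hom.poly_map_poly add: degree_map_poly)
qed

text \<open>An integral inverse of \<open>u = 1 - s \<theta>\<close> would be a polynomial in
  \<open>u\<close>, which gives an integer polynomial \<open>h\<close> vanishing at \<theta>, hence
  a multiple of \<open>p\<close>. Evaluating at \<open>1 / s\<close>, where \<open>1 - s X\<close>
  vanishes, shows that the value of the reciprocal polynomial at \<open>s\<close> divides a power of
  \<open>s\<close>; being congruent to 1 modulo \<open>s\<close>, it would be a unit.\<close>

lemma one_minus_mult_not_unit:
  fixes p :: "int poly" and \<theta> :: complex and s :: int
  assumes monic: "lead_coeff p = 1"
    and min: "\<And>g :: int poly. poly (map_poly of_int g) \<theta> = 0 \<Longrightarrow> p dvd g"
    and s: "s \<noteq> 0" and P: "\<bar>poly (reflect_poly p) s\<bar> \<ge> 2"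
    and u0: "1 - of_int s * \<theta> \<noteq> 0"
  shows "\<not> alg_int (1 / (1 - of_int s * \<theta>))"
proof
  define u where "u = 1 - of_int s * \<theta>"
  assume "alg_int (1 / (1 - of_int s * \<theta>))"
  then obtain g :: "int poly" where g: "1 / u = poly (map_poly of_int g) u"
    using inverse_unit_in_poly[of u] u0 by (auto simp: u_def)
  define h where "h = [:1, -s:] * pcompose g [:1, -s:] - 1"
  have lin: "poly (map_poly of_int [:1, -s:]) \<theta> = u"
    using s by (simp add: u_def map_poly_pCons mult.commute)
  have "poly (map_poly of_int h) \<theta> = u * (1 / u) - 1"
    unfolding h_def of_int_poly_hom.hom_minus of_int_poly_hom.hom_mult of_int_hom.map_poly_pcompose
    by (simp only: poly_diff poly_mult poly_pcompose lin g) simp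
  then have "p dvd h" using min u0 by (simp add: u_def)
  then obtain r where r: "h = p * r" by (auto elim: dvdE)
  \<comment> \<open>The constant coefficient of the reciprocal polynomial is the leading coefficient
    of \<open>p\<close>, namely 1.\<close>
  obtain m where m: "poly (reflect_poly p) s = 1 + s * m"
  proof -
    obtain a t where t: "reflect_poly p = pCons a t" by (cases "reflect_poly p" rule: pCons_cases)
    then have "a = 1" using monic by (metis coeff_0_reflect_poly coeff_pCons_0)
    then have "poly (reflect_poly p) s = 1 + s * poly t s" using t by simp
    then show ?thesis by (rule that)
  qed
  let ?R = "map_poly of_int :: int poly \<Rightarrow> real poly"
  let ?y = "inverse (of_int s) :: real"
  have "poly (?R h) ?y = -1"
    unfolding h_def of_int_poly_hom.hom_minus of_int_poly_hom.hom_mult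
    using s by (simp add: map_poly_pCons)
  then have "poly (?R p) ?y * poly (?R r) ?y = -1"
    unfolding r of_int_poly_hom.hom_mult by simp
  then have "(of_int (poly (reflect_poly p) s * poly (reflect_poly r) s) :: real)
      = of_int (- (s ^ (degree p + degree r)))"
    by (simp add: power_add of_int_poly_reflect_poly[OF s] mult_ac)
  then have "poly (reflect_poly p) s * poly (reflect_poly r) s = - (s ^ (degree p + degree r))"
    using of_int_eq_iff by blast
  then have "poly (reflect_poly p) s dvd s ^ (degree p + degree r)"
    by (metis dvd_minus_iff dvd_triv_left)
  moreover have "coprime (1 + s * m) s"
    by (rule coprimeI) (metis dvd_add_left_iff dvd_mult2)
  then have "coprime (poly (reflect_poly p) s) (s ^ (degree p + degree r))"
    unfolding m by simp
  ultimately have "is_unit (poly (reflect_poly p) s)"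
    by (metis coprime_common_divisor dvd_refl)
  then show False using P by (simp add: zdvd1_eq)
qed

text \<open>As \<theta> is a root, the reciprocal value is
  \<open>s ^ k * (p(1 / s) - p(\<theta>))\<close>; termwise this is a combination of differences
  \<open>1 - (s \<theta>) ^ i\<close>, each divisible by \<open>1 - s \<theta>\<close>.\<close>

lemma one_minus_mult_dvd_reflect:
  fixes p :: "int poly" and \<theta> :: complex and s :: int
  assumes root: "poly (map_poly of_int p) \<theta> = 0" and \<theta>: "alg_int \<theta>" and s: "s \<noteq> 0"
  shows "\<exists>w. alg_int w \<and> of_int (poly (reflect_poly p) s) = (1 - of_int s * \<theta>) * w"
proof -
  define k where "k = degree p"
  define w where "w = (\<Sum>i\<le>k. of_int (coeff p i) * of_int s ^ (k - i) * (\<Sum>j<i. (of_int s * \<theta>) ^ j))"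
  have "of_int (poly (reflect_poly p) s)
      = of_int s ^ k * (poly (map_poly of_int p) (inverse (of_int s)) - poly (map_poly of_int p) \<theta>)"
    using root of_int_poly_reflect_poly[OF s, of p] by (simp add: k_def)
  also have "\<dots> = (\<Sum>i\<le>k. of_int s ^ k * (of_int (coeff p i) * (inverse (of_int s) ^ i - \<theta> ^ i)))"
    by (simp add: poly_altdef degree_map_poly coeff_map_poly k_def sum_distrib_left
        right_diff_distrib sum_subtractf)
  also have "\<dots> = (\<Sum>i\<le>k. of_int (coeff p i) * of_int s ^ (k - i) * (1 - (of_int s * \<theta>) ^ i))"
    using s by (intro sum.cong refl) (simp add: power_diff field_simps power_mult_distrib)
  also have "\<dots> = (1 - of_int s * \<theta>) * w"
    unfolding w_def sum_distrib_left
    by (intro sum.cong refl) (simp add: one_diff_power_eq mult_ac flip: sum_distrib_left)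
  finally show ?thesis
    unfolding w_def by (intro exI[of _ w] conjI) (auto simp: w_def intro!: alg_int_intros \<theta>)
qed

text \<open>A nonzero constant coefficient keeps the reciprocal polynomial nonconstant, so it takes
  the values 0, 1 and -1 only finitely often, while \<open>A\<close> has infinitely many
  multiples.\<close>

lemma exists_large_reflect_value:
  fixes p :: "int poly" and A :: int
  assumes deg: "degree p > 0" and p0: "coeff p 0 \<noteq> 0" and A: "A \<noteq> 0"
  shows "\<exists>s. s \<noteq> 0 \<and> A dvd s \<and> \<bar>poly (reflect_poly p) s\<bar> \<ge> 2"
proof -
  define P where "P = reflect_poly p"
  have dP: "degree P > 0" using deg p0 by (simp add: P_def)
  define F where "F = P * (P - 1) * (P + 1) * [:0, 1:]"
  have "P \<noteq> 0" "P - 1 \<noteq> 0" "P + 1 \<noteq> 0"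
    using dP by (auto simp: eq_neg_iff_add_eq_0[symmetric])
  then have "F \<noteq> 0" by (simp add: F_def)
  then have "finite {s. poly F s = 0}" by (rule poly_roots_finite)
  moreover have "infinite (range ((*) A))"
    using A by (simp add: finite_image_iff inj_on_def infinite_UNIV_int)
  ultimately obtain s where s: "s \<in> range ((*) A)" "poly F s \<noteq> 0"
    by (metis (mono_tags, lifting) mem_Collect_eq rev_finite_subset subsetI)
  then show ?thesis by (intro exI[of _ s]) (auto simp: F_def P_def)
qed

section \<open>Number fields and their Galois groups\<close>

lemma common_denominator:
  assumes "finite F"
  shows "\<exists>N::int. N \<noteq> 0 \<and> (\<forall>q\<in>F. \<exists>k::int. of_int N * (q::rat) = of_int k)"
  using assms
proof (induct F)
  case (insert q F)
  then obtain N :: int where N: "N \<noteq> 0" "\<And>q. q \<in> F \<Longrightarrow> \<exists>k::int. of_int N * q = of_int k" by blast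
  obtain a b :: int where ab: "q = of_int a / of_int b" "b \<noteq> 0"
    by (metis quotient_of_denom_pos' quotient_of_div surj_pair less_irrefl snd_conv)
  have "\<exists>k::int. of_int (N * b) * x = of_int k" if x: "x \<in> insert q F" for x
  proof (cases "x = q")
    case True
    then show ?thesis using ab by (intro exI[of _ "N * a"]) simp
  next
    case False
    then obtain k where "of_int N * x = of_int k" using x N by blast
    then have "of_int (N * b) * x = of_int (k * b)" by (metis mult.assoc mult.commute of_int_mult)
    then show ?thesis by blast
  qed
  moreover have "N * b \<noteq> 0" using N ab by simp
  ultimately show ?case by blast
qed (auto intro: exI[of _ 1])

locale number_field =
  fixes L :: "complex set"
  assumes subfield: "is_subfield L"
    and finite_dim: "\<exists>B. finite B \<and> B \<subseteq> L \<and> (\<forall>x\<in>L. \<exists>c. x = (\<Sum>b\<in>B. of_rat (c b) * b))"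
begin

lemma zero_closed [simp]: "0 \<in> L" and one_closed [simp]: "1 \<in> L"
  and add_closed: "x \<in> L \<Longrightarrow> y \<in> L \<Longrightarrow> x + y \<in> L"
  and mult_closed: "x \<in> L \<Longrightarrow> y \<in> L \<Longrightarrow> x * y \<in> L"
  and uminus_closed: "x \<in> L \<Longrightarrow> - x \<in> L"
  and inverse_closed: "x \<in> L \<Longrightarrow> inverse x \<in> L"
  using subfield unfolding is_subfield_def by auto

lemma diff_closed: "x \<in> L \<Longrightarrow> y \<in> L \<Longrightarrow> x - y \<in> L"
  using add_closed[of x "- y"] uminus_closed by simp

lemma divide_closed: "x \<in> L \<Longrightarrow> y \<in> L \<Longrightarrow> x / y \<in> L"
  by (simp add: divide_inverse mult_closed inverse_closed)

lemma of_nat_closed [simp]: "of_nat k \<in> L"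
  by (induct k) (auto intro: add_closed)

lemma of_int_closed [simp]: "of_int k \<in> L"
  by (cases k rule: int_cases2) (auto intro: uminus_closed)

lemma of_rat_closed [simp]: "of_rat q \<in> L"
  by (cases q) (simp add: of_rat_rat divide_closed)

lemma power_closed: "x \<in> L \<Longrightarrow> x ^ k \<in> L"
  by (induct k) (auto intro: mult_closed)

lemma sum_closed: "(\<And>i. i \<in> I \<Longrightarrow> f i \<in> L) \<Longrightarrow> sum f I \<in> L"
  by (induct I rule: infinite_finite_induct) (auto intro: add_closed)

lemma prod_closed: "(\<And>i. i \<in> I \<Longrightarrow> f i \<in> L) \<Longrightarrow> prod f I \<in> L"
  by (induct I rule: infinite_finite_induct) (auto intro: mult_closed)

lemma power_int_closed: "x \<in> L \<Longrightarrow> x powi k \<in> L"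
  by (auto simp: power_int_def intro: power_closed inverse_closed)

lemmas field_closed = add_closed mult_closed uminus_closed inverse_closed diff_closed
  divide_closed power_closed sum_closed prod_closed power_int_closed
  zero_closed one_closed of_int_closed of_nat_closed of_rat_closed

text \<open>Multiplication by \<open>x\<close> on a rational spanning set has rational coefficients;
  clearing their denominators makes \<open>alg_intI_stable_span\<close> applicable.\<close>

lemma exists_integral_multiple:
  assumes x: "x \<in> L"
  shows "\<exists>N::int. N \<noteq> 0 \<and> alg_int (of_int N * x)"
proof -
  obtain B where B: "finite B" "B \<subseteq> L" "\<And>x. x \<in> L \<Longrightarrow> \<exists>c. x = (\<Sum>b\<in>B. of_rat (c b) * b)"
    using finite_dim by blast
  have "\<exists>c. x * b = (\<Sum>b'\<in>B. of_rat (c b') * b')" if "b \<in> B" for b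
    using that B x by (intro B(3)) (auto intro: mult_closed)
  then obtain c where c: "\<And>b. b \<in> B \<Longrightarrow> x * b = (\<Sum>b'\<in>B. of_rat (c b b') * b')" by metis
  have "finite (case_prod c ` (B \<times> B))" using B by simp
  from common_denominator[OF this] obtain N :: int where N: "N \<noteq> 0"
    "\<And>b b'. b \<in> B \<Longrightarrow> b' \<in> B \<Longrightarrow> \<exists>k::int. of_int N * c b b' = of_int k" by fastforce
  then obtain k where k: "\<And>b b'. b \<in> B \<Longrightarrow> b' \<in> B \<Longrightarrow> of_int N * c b b' = of_int (k b b')"
    by metis
  \<comment> \<open>Otherwise all combinations would vanish, including the one for 1.\<close>
  have "\<exists>b\<in>B. b \<noteq> 0"
  proof (rule ccontr)
    assume "\<not> (\<exists>b\<in>B. b \<noteq> 0)"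
    then have "(\<Sum>b\<in>B. of_rat (c b) * b) = 0" for c :: "complex \<Rightarrow> rat"
      by (intro sum.neutral) auto
    then show False using B(3)[of 1] by simp
  qed
  then obtain b0 where b0: "b0 \<in> B" "b0 \<noteq> 0" by blast
  have "alg_int (of_int N * x)"
  proof (rule alg_intI_stable_span[OF B(1) b0])
    fix b assume b: "b \<in> B"
    have "of_int N * x * b = of_int N * (\<Sum>b'\<in>B. of_rat (c b b') * b')"
      using c[OF b] by (simp add: mult.assoc)
    also have "\<dots> = (\<Sum>b'\<in>B. of_rat (of_int N * c b b') * b')"
      by (simp add: sum_distrib_left mult_ac of_rat_mult)
    also have "\<dots> = (\<Sum>b'\<in>B. of_int (k b b') * b')"
      using k[OF b] by (intro sum.cong refl) simp
    also have "\<dots> \<in> zmod.span B"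
      by (intro zmod.span_sum zmod.span_scale zmod.span_base)
    finally show "of_int N * x * b \<in> zmod.span B" .
  qed
  then show ?thesis using N by blast
qed

section \<open>Field automorphisms and their inverses\<close>

context
  fixes \<sigma> assumes \<sigma>: "\<sigma> \<in> gal L"
begin

lemma gal_add: "x \<in> L \<Longrightarrow> y \<in> L \<Longrightarrow> \<sigma> (x + y) = \<sigma> x + \<sigma> y"
  and gal_mult: "x \<in> L \<Longrightarrow> y \<in> L \<Longrightarrow> \<sigma> (x * y) = \<sigma> x * \<sigma> y"
  and gal_one: "\<sigma> 1 = 1"
  and gal_bij: "bij_betw \<sigma> L L"
  and gal_outside: "x \<notin> L \<Longrightarrow> \<sigma> x = x"
  using \<sigma> by (auto simp: gal_def ring_hom_on_def)

lemma gal_closed: "x \<in> L \<Longrightarrow> \<sigma> x \<in> L"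
  using gal_bij by (auto simp: bij_betw_def)

lemma gal_zero: "\<sigma> 0 = 0"
  using gal_add[of 0 0] by simp

lemma gal_uminus: "x \<in> L \<Longrightarrow> \<sigma> (- x) = - \<sigma> x"
  using gal_add[of x "- x"] uminus_closed gal_zero by (simp add: add_eq_0_iff)

lemma gal_diff: "x \<in> L \<Longrightarrow> y \<in> L \<Longrightarrow> \<sigma> (x - y) = \<sigma> x - \<sigma> y"
  using gal_add[of x "- y"] uminus_closed gal_uminus by simp

lemma gal_inverse: "x \<in> L \<Longrightarrow> \<sigma> (inverse x) = inverse (\<sigma> x)"
proof (cases "x = 0")
  case False
  assume x: "x \<in> L"
  have "\<sigma> x * \<sigma> (inverse x) = 1"
    using gal_mult[OF x inverse_closed[OF x]] gal_one False by simp
  then show ?thesis by (rule inverse_unique[symmetric])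
qed (simp add: gal_zero)

lemma gal_of_nat: "\<sigma> (of_nat k) = of_nat k"
  by (induct k) (simp_all add: gal_zero gal_one gal_add)

lemma gal_of_int: "\<sigma> (of_int k) = of_int k"
  by (cases k rule: int_cases2) (simp_all add: gal_uminus gal_of_nat)

lemma gal_of_rat: "\<sigma> (of_rat q) = of_rat q"
  by (cases q) (simp add: of_rat_rat divide_inverse gal_mult gal_inverse gal_of_int field_closed)

lemma gal_power: "x \<in> L \<Longrightarrow> \<sigma> (x ^ k) = \<sigma> x ^ k"
  by (induct k) (simp_all add: gal_one gal_mult power_closed)

lemma gal_sum: "(\<And>i. i \<in> I \<Longrightarrow> f i \<in> L) \<Longrightarrow> \<sigma> (sum f I) = (\<Sum>i\<in>I. \<sigma> (f i))"
  by (induct I rule: infinite_finite_induct) (simp_all add: gal_zero gal_add sum_closed)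

lemma gal_prod: "(\<And>i. i \<in> I \<Longrightarrow> f i \<in> L) \<Longrightarrow> \<sigma> (prod f I) = (\<Prod>i\<in>I. \<sigma> (f i))"
  by (induct I rule: infinite_finite_induct) (simp_all add: gal_one gal_mult prod_closed)

lemma gal_power_int: "x \<in> L \<Longrightarrow> \<sigma> (x powi k) = \<sigma> x powi k"
  by (simp add: power_int_def gal_power gal_inverse inverse_closed)

lemma gal_poly: "x \<in> L \<Longrightarrow> \<sigma> (poly (map_poly of_int p) x) = poly (map_poly of_int p) (\<sigma> x)"
  by (simp add: poly_altdef degree_map_poly coeff_map_poly gal_sum gal_mult gal_of_int gal_power
      field_closed)

text \<open>Automorphisms are extended by the identity outside \<open>L\<close>, so group inverses
  can be taken as inverse functions on all complex numbers.\<close>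

lemma gal_bij_UNIV: "bij \<sigma>"
proof -
  have "bij_betw \<sigma> (- L) (- L)"
    by (rule bij_betwI[of _ _ _ id]) (simp_all add: gal_outside)
  then have "bij_betw \<sigma> (L \<union> - L) (L \<union> - L)"
    by (rule bij_betw_combine[OF gal_bij]) simp
  then show ?thesis by (simp only: Compl_partition)
qed

lemma gal_inv: "inv_into UNIV \<sigma> \<in> gal L"
proof -
  have inv: "\<sigma> (inv_into UNIV \<sigma> x) = x" "inv_into UNIV \<sigma> (\<sigma> x) = x" for x
    using gal_bij_UNIV by (simp_all add: bij_is_surj bij_is_inj surj_f_inv_f)
  have img: "\<sigma> ` L = L" using gal_bij by (simp add: bij_betw_def)
  have inL: "inv_into UNIV \<sigma> x \<in> L" if "x \<in> L" for x
    using that img inv by (metis imageE)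
  have "inv_into UNIV \<sigma> x = x" if "x \<notin> L" for x
    using gal_outside[OF that] inv(2)[of x] by simp
  moreover have "bij_betw (inv_into UNIV \<sigma>) L L"
    by (rule bij_betw_byWitness[of _ \<sigma>]) (auto simp: inv inL gal_closed)
  moreover have "inv_into UNIV \<sigma> 1 = 1" using gal_one inv(2)[of 1] by simp
  moreover have "inv_into UNIV \<sigma> (x + y) = inv_into UNIV \<sigma> x + inv_into UNIV \<sigma> y"
    "inv_into UNIV \<sigma> (x * y) = inv_into UNIV \<sigma> x * inv_into UNIV \<sigma> y"
    if "x \<in> L" "y \<in> L" for x y
    using gal_add[OF inL inL, OF that] gal_mult[OF inL inL, OF that] inv by metis+
  ultimately show ?thesis unfolding gal_def ring_hom_on_def by auto
qed

end

lemma gal_comp: "\<sigma> \<in> gal L \<Longrightarrow> \<tau> \<in> gal L \<Longrightarrow> \<sigma> \<circ> \<tau> \<in> gal L"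
  unfolding gal_def ring_hom_on_def
  by (auto intro: bij_betw_trans simp: bij_betwE)

lemma gal_id: "id \<in> gal L"
  by (simp add: gal_def ring_hom_on_def)

lemma gal_eqI:
  assumes B: "B \<subseteq> L" "\<And>x. x \<in> L \<Longrightarrow> \<exists>c. x = (\<Sum>b\<in>B. of_rat (c b) * b)"
    and \<sigma>: "\<sigma> \<in> gal L" and \<tau>: "\<tau> \<in> gal L" and eq: "\<And>b. b \<in> B \<Longrightarrow> \<sigma> b = \<tau> b"
  shows "\<sigma> = \<tau>"
proof
  fix x
  show "\<sigma> x = \<tau> x"
  proof (cases "x \<in> L")
    case True
    then obtain c where c: "x = (\<Sum>b\<in>B. of_rat (c b) * b)" using B by blast
    have "\<rho> x = (\<Sum>b\<in>B. of_rat (c b) * \<rho> b)" if "\<rho> \<in> gal L" for \<rho>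
      unfolding c using that B(1)
      by (subst gal_sum[OF that]) (auto intro!: sum.cong simp: gal_mult gal_of_rat mult_closed subset_iff)
    from this[OF \<sigma>] this[OF \<tau>] show ?thesis using eq by simp
  qed (simp add: gal_outside[OF \<sigma>] gal_outside[OF \<tau>])
qed

section \<open>Finiteness of the Galois group\<close>

lemma finite_conjugates:
  assumes x: "x \<in> L"
  shows "finite ((\<lambda>\<sigma>. \<sigma> x) ` gal L)"
proof -
  obtain N :: int where N: "N \<noteq> 0" "alg_int (of_int N * x)"
    using exists_integral_multiple[OF x] by blast
  then obtain p :: "int poly" where p: "lead_coeff p = 1" "poly (map_poly of_int p) (of_int N * x) = 0"
    unfolding alg_int_def by blast
  \<comment> \<open>Automorphisms send \<open>of_int N * x\<close> to roots of the same polynomial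
    \<open>p\<close>, and dividing by \<open>N\<close> recovers the conjugates of
    \<open>x\<close>.\<close>
  define R where "R = {y :: complex. poly (map_poly of_int p) y = 0}"
  have "finite R" unfolding R_def
    by (intro poly_roots_finite) (use p(1) in auto)
  moreover have "(\<lambda>\<sigma>. \<sigma> x) ` gal L \<subseteq> (\<lambda>y. y / of_int N) ` R"
  proof
    fix y assume "y \<in> (\<lambda>\<sigma>. \<sigma> x) ` gal L"
    then obtain \<sigma> where \<sigma>: "\<sigma> \<in> gal L" "y = \<sigma> x" by blast
    have "poly (map_poly of_int p) (\<sigma> (of_int N * x)) = 0"
      using p(2) gal_poly[OF \<sigma>(1), of "of_int N * x" p] x gal_zero[OF \<sigma>(1)] by (simp add: mult_closed)
    then have "of_int N * y \<in> R"
      using \<sigma> x by (simp add: R_def gal_mult gal_of_int)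
    then show "y \<in> (\<lambda>y. y / of_int N) ` R" using N by (intro image_eqI[of _ _ "of_int N * y"]) auto
  qed
  ultimately show ?thesis by (meson finite_imageI finite_subset)
qed

text \<open>An automorphism is determined by its restriction to a finite spanning set, where each
  element has only finitely many possible images.\<close>

lemma finite_gal: "finite (gal L)"
proof -
  obtain B where B: "finite B" "B \<subseteq> L" "\<And>x. x \<in> L \<Longrightarrow> \<exists>c. x = (\<Sum>b\<in>B. of_rat (c b) * b)"
    using finite_dim by blast
  have "finite (PiE B (\<lambda>b. (\<lambda>\<sigma>. \<sigma> b) ` gal L))"
    using B finite_conjugates by (intro finite_PiE) auto
  moreover have "(\<lambda>\<sigma>. restrict \<sigma> B) ` gal L \<subseteq> PiE B (\<lambda>b. (\<lambda>\<sigma>. \<sigma> b) ` gal L)" by auto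
  ultimately have "finite ((\<lambda>\<sigma>. restrict \<sigma> B) ` gal L)" by (rule rev_finite_subset)
  moreover have "inj_on (\<lambda>\<sigma>. restrict \<sigma> B) (gal L)"
    using gal_eqI[OF B(2,3)] by (intro inj_onI) (metis restrict_apply')
  ultimately show ?thesis by (rule finite_imageD)
qed

text \<open>The classical argument for primitive elements: \<theta> is the value at a natural number
  \<open>k\<close> of the polynomial whose coefficients are the spanning elements
  \<open>b i\<close>, and \<open>\<sigma> \<theta> - \<theta>\<close> is the value at
  \<open>k\<close> of \<open>F \<sigma>\<close>, which is nonzero for \<sigma> other than the
  identity. Some natural number is a root of none of these finitely many polynomials.\<close>

lemma exists_gal_separating:
  "\<exists>\<theta>\<in>L. \<theta> \<noteq> 0 \<and> (\<forall>\<sigma>\<in>gal L. \<sigma> \<noteq> id \<longrightarrow> \<sigma> \<theta> \<noteq> \<theta>)"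
proof -
  obtain B where B: "finite B" "B \<subseteq> L" "\<And>x. x \<in> L \<Longrightarrow> \<exists>c. x = (\<Sum>b\<in>B. of_rat (c b) * b)"
    using finite_dim by blast
  obtain b where b: "bij_betw b {0..<card B} B" using B ex_bij_betw_nat_finite by blast
  define m where "m = card B"
  have bL: "b i \<in> L" if "i < m" for i using that b B(2) by (auto simp: bij_betw_def m_def)
  define F where "F \<sigma> = (\<Sum>i<m. monom (\<sigma> (b i) - b i) i)" for \<sigma>
  \<comment> \<open>This polynomial secures \<open>\<theta> \<noteq> 0\<close>, which the separation
    condition alone does not give when the Galois group is trivial.\<close>
  define F0 where "F0 = (\<Sum>i<m. monom (b i) i)"
  have coeff: "coeff (\<Sum>i<m. monom (a i) i) j = (if j < m then a j else 0)" for a :: "nat \<Rightarrow> complex" and j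
    by (simp add: coeff_sum)
  have bB: "\<exists>i<m. b i = x" if "x \<in> B" for x
    using b that unfolding bij_betw_def m_def by (metis atLeastLessThan_iff imageE)
  have "F \<sigma> \<noteq> 0" if \<sigma>: "\<sigma> \<in> gal L" "\<sigma> \<noteq> id" for \<sigma>
  proof
    assume "F \<sigma> = 0"
    then have "\<sigma> (b i) = b i" if "i < m" for i
      using coeff[of "\<lambda>i. \<sigma> (b i) - b i" i] that by (simp add: F_def)
    then have "\<sigma> x = id x" if "x \<in> B" for x using bB[OF that] by auto
    then have "\<sigma> = id" using gal_eqI[OF B(2,3) \<sigma>(1) gal_id] by blast
    then show False using \<sigma> by simp
  qed
  moreover have "F0 \<noteq> 0"
  proof
    assume "F0 = 0"
    then have "b i = 0" if "i < m" for i
      using coeff[of b i] that by (simp add: F0_def)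
    then have "x = 0" if "x \<in> B" for x using bB[OF that] by auto
    then have "(\<Sum>b\<in>B. of_rat (c b) * b) = 0" for c :: "complex \<Rightarrow> rat"
      by (intro sum.neutral) auto
    then show False using B(3)[of 1] by simp
  qed
  ultimately have "F0 * (\<Prod>\<sigma>\<in>gal L - {id}. F \<sigma>) \<noteq> 0" (is "?G \<noteq> 0")
    using finite_gal by simp
  then have "finite {s. poly ?G s = 0}" by (rule poly_roots_finite)
  moreover have "infinite (range (of_nat :: nat \<Rightarrow> complex))"
    by (intro range_inj_infinite) (simp add: inj_on_def)
  ultimately obtain k :: nat where "poly ?G (of_nat k) \<noteq> 0"
    by (metis (mono_tags, lifting) image_subset_iff mem_Collect_eq rev_finite_subset)
  then have k: "poly F0 (of_nat k) \<noteq> 0" "\<And>\<sigma>. \<sigma> \<in> gal L \<Longrightarrow> \<sigma> \<noteq> id \<Longrightarrow> poly (F \<sigma>) (of_nat k) \<noteq> 0"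
    using finite_gal by (auto simp: poly_prod)
  define \<theta> where "\<theta> = (\<Sum>i<m. b i * of_nat k ^ i)"
  have "\<theta> = poly F0 (of_nat k)" by (simp add: \<theta>_def F0_def poly_sum poly_monom)
  moreover have "\<theta> \<in> L" unfolding \<theta>_def by (intro field_closed) (auto simp: bL)
  moreover have "\<sigma> \<theta> - \<theta> = poly (F \<sigma>) (of_nat k)" if \<sigma>: "\<sigma> \<in> gal L" for \<sigma>
  proof -
    have "\<sigma> \<theta> = (\<Sum>i<m. \<sigma> (b i) * of_nat k ^ i)"
      unfolding \<theta>_def
      by (subst gal_sum[OF \<sigma>]) (auto simp: gal_mult[OF \<sigma>] gal_power[OF \<sigma>] gal_of_nat[OF \<sigma>] field_closed bL)
    then show ?thesis
      by (simp add: \<theta>_def F_def poly_sum poly_monom left_diff_distrib sum_subtractf)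
  qed
  ultimately show ?thesis using k by (metis eq_iff_diff_eq_0)
qed

text \<open>Each \<open>1 / (\<theta> - \<sigma> \<theta>)\<close> has a nonzero integer multiple
  that is integral; the product of these integers over the finite group serves as
  \<open>D\<close>.\<close>

lemma exists_conjugate_difference_multiple:
  assumes \<theta>: "\<theta> \<in> L" "\<And>\<sigma>. \<sigma> \<in> gal L \<Longrightarrow> \<sigma> \<noteq> id \<Longrightarrow> \<sigma> \<theta> \<noteq> \<theta>"
  shows "\<exists>D::int. D \<noteq> 0 \<and> (\<forall>\<sigma>\<in>gal L - {id}. \<exists>z. alg_int z \<and> (\<theta> - \<sigma> \<theta>) * z = of_int D)"
proof -
  have "\<exists>N::int. N \<noteq> 0 \<and> alg_int (of_int N * (1 / (\<theta> - \<sigma> \<theta>)))" if "\<sigma> \<in> gal L - {id}" for \<sigma>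
    using that \<theta>(1) gal_closed[of \<sigma> \<theta>] by (intro exists_integral_multiple field_closed) auto
  then obtain N :: "_ \<Rightarrow> int" where N: "\<And>\<sigma>. \<sigma> \<in> gal L - {id} \<Longrightarrow> N \<sigma> \<noteq> 0"
    "\<And>\<sigma>. \<sigma> \<in> gal L - {id} \<Longrightarrow> alg_int (of_int (N \<sigma>) * (1 / (\<theta> - \<sigma> \<theta>)))" by metis
  define D where "D = (\<Prod>\<sigma>\<in>gal L - {id}. N \<sigma>)"
  have "\<exists>z. alg_int z \<and> (\<theta> - \<sigma> \<theta>) * z = of_int D" if \<sigma>: "\<sigma> \<in> gal L - {id}" for \<sigma>
  proof -
    obtain e where e: "D = N \<sigma> * e"
      using dvd_prodI[of "gal L - {id}" \<sigma> N] \<sigma> finite_gal unfolding D_def by (auto elim: dvdE)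
    have "\<theta> - \<sigma> \<theta> \<noteq> 0" using \<theta>(2)[of \<sigma>] \<sigma> by auto
    then show ?thesis
      by (intro exI[of _ "of_int (N \<sigma>) * (1 / (\<theta> - \<sigma> \<theta>)) * of_int e"] conjI alg_int_mult N(2) \<sigma>)
        (simp_all add: e)
  qed
  moreover have "D \<noteq> 0" using N finite_gal by (simp add: D_def)
  ultimately show ?thesis by blast
qed

end

section \<open>Comaximal algebraic integers\<close>

text \<open>The coefficients range over all algebraic integers rather than those of a fixed field,
  so no membership in \<open>L\<close> has to be tracked.\<close>

definition alg_int_comaximal :: "complex \<Rightarrow> complex \<Rightarrow> bool" where
  "alg_int_comaximal x y \<longleftrightarrow> (\<exists>u v. alg_int u \<and> alg_int v \<and> u * x + v * y = 1)"

lemma alg_int_comaximal_sym: "alg_int_comaximal x y \<Longrightarrow> alg_int_comaximal y x"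
  unfolding alg_int_comaximal_def by (metis add.commute)

lemma alg_int_comaximal_one: "alg_int_comaximal x 1"
  unfolding alg_int_comaximal_def by (intro exI[of _ 0] exI[of _ 1]) simp

lemma alg_int_comaximal_mult:
  assumes y: "alg_int y" and xy: "alg_int_comaximal x y" and xz: "alg_int_comaximal x z"
  shows "alg_int_comaximal x (y * z)"
proof -
  obtain u v where uv: "alg_int u" "alg_int v" "u * x + v * y = 1"
    using xy unfolding alg_int_comaximal_def by blast
  obtain u' v' where uv': "alg_int u'" "alg_int v'" "u' * x + v' * z = 1"
    using xz unfolding alg_int_comaximal_def by blast
  have "1 = u * x + v * y * (u' * x + v' * z)" using uv uv' by simp
  then have "(u + v * y * u') * x + (v * v') * (y * z) = 1" by (simp add: algebra_simps)
  then show ?thesis unfolding alg_int_comaximal_def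
    using uv uv' y by (intro exI[of _ "u + v * y * u'"] exI[of _ "v * v'"])
      (auto intro!: alg_int_add alg_int_mult)
qed

lemma alg_int_comaximal_power:
  "alg_int y \<Longrightarrow> alg_int_comaximal x y \<Longrightarrow> alg_int_comaximal x (y ^ k)"
  by (induct k) (auto intro: alg_int_comaximal_one alg_int_comaximal_mult)

lemma alg_int_comaximal_prod:
  assumes "\<And>i. i \<in> I \<Longrightarrow> alg_int (f i)" "\<And>i. i \<in> I \<Longrightarrow> alg_int_comaximal x (f i)"
  shows "alg_int_comaximal x (prod f I)"
  using assms
  by (induct I rule: infinite_finite_induct)
    (auto intro: alg_int_comaximal_one alg_int_comaximal_mult)

text \<open>The two elements differ by \<open>s * (\<theta> - \<theta>')\<close>, which divides
  \<open>s ^ 2\<close> among the algebraic integers because \<open>D\<close> divides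
  \<open>s\<close>; and \<open>1 - s \<theta>\<close> is comaximal to \<open>s ^ 2\<close> through
  \<open>(1 + s \<theta>) * (1 - s \<theta>) = 1 - s ^ 2 * \<theta> ^ 2\<close>.\<close>

lemma alg_int_comaximal_conjugates:
  fixes D s :: int
  assumes "alg_int \<theta>" "alg_int z" and z: "(\<theta> - \<theta>') * z = of_int D" and "D dvd s"
  shows "alg_int_comaximal (1 - of_int s * \<theta>) (1 - of_int s * \<theta>')"
proof -
  obtain q where q: "s = D * q" using \<open>D dvd s\<close> by blast
  define v where "v = \<theta> ^ 2 * of_int q * z"
  have "of_int s * of_int s = (of_int s :: complex) * (of_int q * ((\<theta> - \<theta>') * z))"
    unfolding z by (simp add: q)
  moreover have "(1 + of_int s * \<theta> - v) * (1 - of_int s * \<theta>) + v * (1 - of_int s * \<theta>')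
      = 1 - \<theta> ^ 2 * (of_int s * of_int s - of_int s * (of_int q * ((\<theta> - \<theta>') * z)))"
    by (simp add: v_def power2_eq_square algebra_simps)
  ultimately have "(1 + of_int s * \<theta> - v) * (1 - of_int s * \<theta>) + v * (1 - of_int s * \<theta>') = 1"
    by simp
  then show ?thesis
    unfolding alg_int_comaximal_def
    using assms(1,2) by (intro exI[of _ "1 + of_int s * \<theta> - v"] exI[of _ v])
      (auto simp: v_def intro!: alg_int_intros)
qed

text \<open>The element \<open>1 - s \<theta>\<close> divides the reciprocal value at
  \<open>s\<close> and hence \<open>s'\<close>, so \<open>1 - s' \<theta>'\<close> is congruent to 1
  modulo it for every integral \<open>\<theta>'\<close>.\<close>

lemma alg_int_comaximal_if_reflect_dvd:
  fixes p :: "int poly" and s s' :: int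
  assumes "poly (map_poly of_int p) \<theta> = 0" "alg_int \<theta>" "alg_int \<theta>'" "s \<noteq> 0"
    and "poly (reflect_poly p) s dvd s'"
  shows "alg_int_comaximal (1 - of_int s * \<theta>) (1 - of_int s' * \<theta>')"
proof -
  obtain w where w: "alg_int w" "of_int (poly (reflect_poly p) s) = (1 - of_int s * \<theta>) * w"
    using one_minus_mult_dvd_reflect assms by blast
  obtain q where q: "s' = poly (reflect_poly p) s * q" using assms(5) by blast
  have "(w * of_int q * \<theta>') * (1 - of_int s * \<theta>) + 1 * (1 - of_int s' * \<theta>') = 1"
    by (simp add: q w algebra_simps)
  then show ?thesis
    unfolding alg_int_comaximal_def
    using w(1) assms(3) by (intro exI[of _ "w * of_int q * \<theta>'"] exI[of _ 1]) (auto intro!: alg_int_intros)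
qed

section \<open>Integrality of products with integer exponents\<close>

lemma power_int_eq_power_divide:
  fixes x :: "'a :: field"
  shows "x powi e = x ^ nat e / x ^ nat (- e)"
  by (simp add: power_int_def field_simps)

text \<open>Moving the negative powers to the other side makes \<open>c i0\<close> divide a product
  of powers of the other factors. Being comaximal to each of them, it is comaximal to that product
  and so a unit.\<close>

lemma alg_int_inverse_if_prod_power_int:
  assumes fin: "finite I" and i0: "i0 \<in> I" and e: "e i0 < 0"
    and c: "\<And>i. i \<in> I \<Longrightarrow> alg_int (c i)" "\<And>i. i \<in> I \<Longrightarrow> c i \<noteq> 0"
    and comax: "\<And>i. i \<in> I \<Longrightarrow> i \<noteq> i0 \<Longrightarrow> alg_int_comaximal (c i0) (c i)"
    and int: "alg_int (\<Prod>i\<in>I. c i powi e i)"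
  shows "alg_int (1 / c i0)"
proof -
  define Y where "Y = (\<Prod>i\<in>I. c i powi e i)"
  define num where "num = (\<Prod>i\<in>I - {i0}. c i ^ nat (e i))"
  define den where "den = (\<Prod>i\<in>I - {i0}. c i ^ nat (- e i))"
  obtain k where k: "nat (- e i0) = Suc k" using e by (cases "nat (- e i0)") auto
  have den0: "den \<noteq> 0" using c fin by (simp add: den_def)
  have "Y = c i0 powi e i0 * (\<Prod>i\<in>I - {i0}. c i powi e i)"
    unfolding Y_def using fin i0 by (rule prod.remove)
  also have "(\<Prod>i\<in>I - {i0}. c i powi e i) = num / den"
    unfolding num_def den_def power_int_eq_power_divide by (rule prod_dividef)
  also have "c i0 powi e i0 = 1 / c i0 ^ Suc k"
    using e k by (simp add: power_int_eq_power_divide)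
  finally have num: "num = c i0 * (Y * c i0 ^ k * den)"
    using den0 c(2)[OF i0] by (simp add: field_simps)
  have "alg_int_comaximal (c i0) num"
    unfolding num_def
    by (intro alg_int_comaximal_prod alg_int_comaximal_power c alg_int_power comax) (use i0 in auto)
  then obtain u v where uv: "alg_int u" "alg_int v" "u * c i0 + v * num = 1"
    unfolding alg_int_comaximal_def by blast
  have "1 / c i0 = u + v * (Y * c i0 ^ k * den)"
    using uv(3) c(2)[OF i0] unfolding num by (simp add: field_simps)
  also have "alg_int \<dots>"
    using uv c i0 int[folded Y_def] unfolding den_def by (intro alg_int_intros) auto
  finally show ?thesis .
qed

text \<open>Each new integer is chosen divisible by all reciprocal values at the earlier ones. The
  disjunction records this without fixing an order on \<open>J\<close>.\<close>

lemma exists_pairwise_reflect_dvd: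
  fixes p :: "int poly" and A :: int
  assumes deg: "degree p > 0" and p0: "coeff p 0 \<noteq> 0" and A: "A \<noteq> 0" and "finite J"
  shows "\<exists>s. (\<forall>j\<in>J. s j \<noteq> 0 \<and> A dvd s j \<and> \<bar>poly (reflect_poly p) (s j)\<bar> \<ge> 2) \<and>
    (\<forall>i\<in>J. \<forall>j\<in>J. i \<noteq> j \<longrightarrow>
      poly (reflect_poly p) (s i) dvd s j \<or> poly (reflect_poly p) (s j) dvd s i)"
  using \<open>finite J\<close>
proof (induct J)
  case (insert a J)
  let ?P = "poly (reflect_poly p)"
  obtain s where s: "\<And>j. j \<in> J \<Longrightarrow> s j \<noteq> 0 \<and> A dvd s j \<and> \<bar>?P (s j)\<bar> \<ge> 2"
    "\<And>i j. i \<in> J \<Longrightarrow> j \<in> J \<Longrightarrow> i \<noteq> j \<Longrightarrow> ?P (s i) dvd s j \<or> ?P (s j) dvd s i"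
    using insert.hyps(3) by metis
  define M where "M = A * (\<Prod>j\<in>J. ?P (s j))"
  have "M \<noteq> 0" using s(1) A insert(1) by (fastforce simp: M_def)
  then obtain t where t: "t \<noteq> 0" "M dvd t" "\<bar>?P t\<bar> \<ge> 2"
    using exists_large_reflect_value[OF deg p0] by blast
  have "?P (s j) dvd M" if "j \<in> J" for j
    unfolding M_def using that insert(1) by (intro dvd_mult dvd_prodI)
  then have dvd: "?P (s j) dvd t" if "j \<in> J" for j using t that dvd_trans by blast
  have "A dvd t" using t dvd_trans[of A M t] by (simp add: M_def)
  then show ?case
    using s t dvd insert(2) by (intro exI[of _ "s(a := t)"]) (auto split: if_splits)
qed simp

section \<open>Integers of \<open>L\<close> congruent to 1 modulo \<open>n\<close>\<close>

context number_field
begin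

text \<open>A multiplicative monoid; products with negative exponents are treated as quotients of
  two of its elements.\<close>

definition one_mod :: "nat \<Rightarrow> complex set" where
  "one_mod n = {x \<in> ring_of_integers L. \<exists>y\<in>ring_of_integers L. x = 1 + of_nat n * y}"

lemma ring_of_integers_intros:
  "x \<in> ring_of_integers L \<Longrightarrow> y \<in> ring_of_integers L \<Longrightarrow> x + y \<in> ring_of_integers L"
  "x \<in> ring_of_integers L \<Longrightarrow> y \<in> ring_of_integers L \<Longrightarrow> x - y \<in> ring_of_integers L"
  "x \<in> ring_of_integers L \<Longrightarrow> y \<in> ring_of_integers L \<Longrightarrow> x * y \<in> ring_of_integers L"
  "of_nat k \<in> ring_of_integers L" "1 \<in> ring_of_integers L" "0 \<in> ring_of_integers L"
  by (auto simp: ring_of_integers_def intro: alg_int_intros field_closed)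

lemma one_mod_one: "1 \<in> one_mod n"
  unfolding one_mod_def using ring_of_integers_intros by (auto intro!: bexI[of _ 0])

lemma one_mod_mult:
  assumes "x \<in> one_mod n" "y \<in> one_mod n"
  shows "x * y \<in> one_mod n"
proof -
  obtain a b where "a \<in> ring_of_integers L" "b \<in> ring_of_integers L"
      "x = 1 + of_nat n * a" "y = 1 + of_nat n * b"
    using assms unfolding one_mod_def by blast
  then show ?thesis
    using assms unfolding one_mod_def
    by (auto intro!: ring_of_integers_intros bexI[of _ "a + b + of_nat n * a * b"] simp: algebra_simps)
qed

lemma one_mod_power: "x \<in> one_mod n \<Longrightarrow> x ^ k \<in> one_mod n"
  by (induct k) (auto intro: one_mod_one one_mod_mult)

lemma one_mod_prod: "(\<And>i. i \<in> I \<Longrightarrow> f i \<in> one_mod n) \<Longrightarrow> prod f I \<in> one_mod n"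
  by (induct I rule: infinite_finite_induct) (auto intro: one_mod_one one_mod_mult)

text \<open>The denominator \<open>y\<close> is congruent to 1 modulo \<open>n\<close>, an element
  of \<pi>, so it lies outside \<pi>, and \<open>x / y - 1\<close> is \<open>n\<close> times a
  fraction with denominator \<open>y\<close>.\<close>

lemma cong_mod_local_divide_one_mod:
  assumes n: "n > 0" and x: "x \<in> one_mod n" and y: "y \<in> one_mod n" and y0: "y \<noteq> 0"
    and \<pi>: "nonzero_prime_ideal L \<pi>" and n\<pi>: "of_nat n \<in> \<pi>"
  shows "cong_mod_local L \<pi> n (x / y) 1"
proof -
  obtain a b where ab: "a \<in> ring_of_integers L" "b \<in> ring_of_integers L"
      "x = 1 + of_nat n * a" "y = 1 + of_nat n * b"
    using x y unfolding one_mod_def by blast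
  let ?O = "ring_of_integers L"
  have ideal: "\<pi> \<subseteq> ?O" "\<And>x y. x \<in> \<pi> \<Longrightarrow> y \<in> \<pi> \<Longrightarrow> x + y \<in> \<pi>"
    "\<And>a x. a \<in> ?O \<Longrightarrow> x \<in> \<pi> \<Longrightarrow> a * x \<in> \<pi>" "\<pi> \<noteq> ?O"
    using \<pi> unfolding nonzero_prime_ideal_def Let_def by auto
  have "y \<notin> \<pi>"
  proof
    assume "y \<in> \<pi>"
    have "0 - b \<in> ?O" using ab ring_of_integers_intros by blast
    then have "y + (0 - b) * of_nat n \<in> \<pi>" using ideal \<open>y \<in> \<pi>\<close> n\<pi> by blast
    then have "1 \<in> \<pi>" using ab by simp
    then have "a \<in> \<pi>" if "a \<in> ?O" for a using ideal(3)[OF that] by fastforce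
    then show False using ideal by blast
  qed
  moreover have "(x / y - 1) / of_nat n = (a - b) / y"
  proof -
    have "x / y - 1 = (x - y) / y" using y0 by (simp add: diff_divide_distrib)
    also have "x - y = of_nat n * (a - b)" by (simp add: ab algebra_simps)
    finally show ?thesis using n by simp
  qed
  moreover have "y \<in> ?O" using y by (simp add: one_mod_def)
  moreover have "a - b \<in> ?O" using ab ring_of_integers_intros(2) by blast
  ultimately show ?thesis
    unfolding cong_mod_local_def local_integers_def by auto
qed

end

section \<open>Construction of the rational point\<close>

theorem theorem1:
  fixes L :: "complex set"
    and act :: "(complex \<Rightarrow> complex) \<Rightarrow> int ^ 'd \<Rightarrow> int ^ 'd"
    and n :: nat
  assumes "finite_galois_ext L"
    and "torus_action L act"
    and "faithful_action L act"
    and "n > 0"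
  shows "\<exists>h. rational_point L act h \<and>
           (\<forall>ch. ch \<noteq> 0 \<longrightarrow> \<not> alg_int (h ch)) \<and>
           (\<forall>ch \<pi>. nonzero_prime_ideal L \<pi> \<and> of_nat n \<in> \<pi> \<longrightarrow> cong_mod_local L \<pi> n (h ch) 1)"
proof -
  interpret number_field L
    using assms(1) unfolding finite_galois_ext_def by unfold_locales auto
  obtain \<theta>0 where \<theta>0: "\<theta>0 \<in> L" "\<theta>0 \<noteq> 0" "\<And>\<sigma>. \<sigma> \<in> gal L \<Longrightarrow> \<sigma> \<noteq> id \<Longrightarrow> \<sigma> \<theta>0 \<noteq> \<theta>0"
    using exists_gal_separating by blast
  \<comment> \<open>Scaling by the nonzero integers \<open>N\<close> and \<open>r\<close> keeps the
    stabiliser trivial; \<open>N\<close> makes the element integral and \<open>r\<close> gives it a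
    monic polynomial dividing every integer polynomial that vanishes there.\<close>
  obtain N :: int where N: "N \<noteq> 0" "alg_int (of_int N * \<theta>0)"
    using exists_integral_multiple[OF \<theta>0(1)] by blast
  obtain r :: int and p :: "int poly" where p: "r \<noteq> 0" "lead_coeff p = 1" "degree p > 0"
    "poly (map_poly of_int p) (of_int r * (of_int N * \<theta>0)) = 0"
    "\<And>g :: int poly. poly (map_poly of_int g) (of_int r * (of_int N * \<theta>0)) = 0 \<Longrightarrow> p dvd g"
    using exists_minimal_monic_multiple[OF N(2)] by blast
  define \<theta> where "\<theta> = of_int r * (of_int N * \<theta>0)"
  have \<theta>L: "\<theta> \<in> L" unfolding \<theta>_def by (intro field_closed \<theta>0)
  have \<theta>: "\<theta> \<noteq> 0" "\<And>\<sigma>. \<sigma> \<in> gal L \<Longrightarrow> \<sigma> \<noteq> id \<Longrightarrow> \<sigma> \<theta> \<noteq> \<theta>"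
    using \<theta>0 N p(1) by (simp_all add: \<theta>_def gal_mult gal_of_int field_closed)
  have root: "poly (map_poly of_int p) (\<sigma> \<theta>) = 0" if "\<sigma> \<in> gal L" for \<sigma>
    using gal_poly[OF that \<theta>L, of p] gal_zero[OF that] p(4) by (simp add: \<theta>_def)
  have int: "alg_int (\<sigma> \<theta>)" if "\<sigma> \<in> gal L" for \<sigma>
    using root[OF that] p(2) unfolding alg_int_def by blast
  \<comment> \<open>If \<open>p = X q\<close>, then \<open>q\<close> would vanish at the nonzero
    \<theta>, against the minimality of \<open>p\<close>.\<close>
  have p0: "coeff p 0 \<noteq> 0"
  proof
    assume "coeff p 0 = 0"
    then obtain q where q: "p = pCons 0 q" by (cases p) auto
    have "q \<noteq> 0" using q p(3) by auto
    then have "poly (map_poly of_int q) \<theta> = 0"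
      using p(4) \<theta>(1) unfolding q \<theta>_def[symmetric] by (simp add: map_poly_pCons)
    then have "p dvd q" using p(5) by (simp add: \<theta>_def)
    then have "degree p \<le> degree q" using \<open>q \<noteq> 0\<close> by (rule dvd_imp_degree_le)
    then show False using q \<open>q \<noteq> 0\<close> by simp
  qed
  obtain D :: int where D: "D \<noteq> 0"
    "\<And>\<sigma>. \<sigma> \<in> gal L \<Longrightarrow> \<sigma> \<noteq> id \<Longrightarrow> \<exists>z. alg_int z \<and> (\<theta> - \<sigma> \<theta>) * z = of_int D"
    using exists_conjugate_difference_multiple[where \<theta> = \<theta>] \<theta>L \<theta>(2) by (metis DiffI singletonD)
  let ?P = "poly (reflect_poly p)"
  \<comment> \<open>The index set holds each coordinate form of the character lattice with both
    signs. The factor \<open>int n\<close> yields the congruence, the factor \<open>D\<close> the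
    comaximality of conjugates.\<close>
  have "finite (UNIV :: ('d \<times> bool) set)" by simp
  moreover have "int n * D \<noteq> 0" using D(1) assms(4) by simp
  ultimately
  obtain s :: "'d \<times> bool \<Rightarrow> int" where s: "\<And>j. s j \<noteq> 0" "\<And>j. int n * D dvd s j"
    "\<And>j. \<bar>?P (s j)\<bar> \<ge> 2" "\<And>i j. i \<noteq> j \<Longrightarrow> ?P (s i) dvd s j \<or> ?P (s j) dvd s i"
    using exists_pairwise_reflect_dvd[OF p(3) p0] by (metis UNIV_I)
  \<comment> \<open>Since \<open>s j\<close> is an integer, \<open>c (j, \<sigma>)\<close> is the
    image of \<open>c (j, id)\<close> under \<sigma>.\<close>
  define c :: "('d \<times> bool) \<times> (complex \<Rightarrow> complex) \<Rightarrow> complex"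
    where "c = (\<lambda>(j, \<sigma>). 1 - of_int (s j) * \<sigma> \<theta>)"
  define I where "I = (UNIV :: ('d \<times> bool) set) \<times> gal L"
  define w :: "'d \<times> bool \<Rightarrow> int ^ 'd \<Rightarrow> int"
    where "w = (\<lambda>(k, b) ch. (if b then 1 else -1) * vec_nth ch k)"
  \<comment> \<open>Taking the inverse of \<sigma> here is what makes \<open>h\<close> equivariant,
    as the group acts from the left on both the field and the characters.\<close>
  define e where "e ch = (\<lambda>(j, \<sigma>). w j (act (inv_into UNIV \<sigma>) ch))" for ch
  define h where "h ch = (\<Prod>i\<in>I. c i powi e ch i)" for ch
  have fin: "finite I" by (simp add: I_def finite_gal)
  have cL: "c i \<in> L" if "i \<in> I" for i
    using that gal_closed[OF _ \<theta>L] by (auto simp: I_def c_def intro!: field_closed)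
  have cint: "alg_int (c i)" if "i \<in> I" for i
    using that int by (auto simp: I_def c_def intro!: alg_int_intros)
  have c0: "c i \<noteq> 0" if "i \<in> I" for i
  proof -
    obtain j \<sigma> where i: "i = (j, \<sigma>)" "\<sigma> \<in> gal L" using \<open>i \<in> I\<close> by (auto simp: I_def)
    obtain z where "of_int (?P (s j)) = (1 - of_int (s j) * \<sigma> \<theta>) * z"
      using one_minus_mult_dvd_reflect[OF root[OF i(2)] int[OF i(2)] s(1)] by blast
    moreover have "?P (s j) \<noteq> 0" using s(3)[of j] by auto
    ultimately show ?thesis by (auto simp: i c_def)
  qed
  have comax: "alg_int_comaximal (c (j, id)) (c i)" if "i \<in> I" and ne: "i \<noteq> (j, id)" for i j
  proof -
    obtain k \<sigma> where i: "i = (k, \<sigma>)" "\<sigma> \<in> gal L" using \<open>i \<in> I\<close> by (auto simp: I_def)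
    \<comment> \<open>For equal indices the automorphism differs from the identity and
      \<open>D\<close> applies; for distinct ones the reciprocal values do, in whichever direction
      the divisibility holds.\<close>
    show ?thesis
    proof (cases "k = j")
      case True
      then obtain z where "alg_int z" "(\<theta> - \<sigma> \<theta>) * z = of_int D"
        using D(2)[OF i(2)] i(1) ne by auto
      moreover have "D dvd s j" using s(2) by (metis dvd_mult_right)
      ultimately show ?thesis
        using alg_int_comaximal_conjugates int[OF gal_id] True by (simp add: c_def i)
    next
      case False
      note 1 = alg_int_comaximal_if_reflect_dvd[OF root[OF gal_id] int[OF gal_id] int[OF i(2)]
          s(1)[of j], of "s k"]
      note 2 = alg_int_comaximal_if_reflect_dvd[OF root[OF i(2)] int[OF i(2)] int[OF gal_id]
          s(1)[of k], of "s j"]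
      from s(4)[OF False] 1 alg_int_comaximal_sym[OF 2] show ?thesis
        by (auto simp: c_def i)
    qed
  qed
  have act_add: "act \<sigma> (a + b) = act \<sigma> a + act \<sigma> b" if "\<sigma> \<in> gal L" for \<sigma> a b
    using assms(2) that unfolding torus_action_def by blast
  have act_comp: "act \<sigma> (act \<tau> a) = act (\<sigma> \<circ> \<tau>) a" if "\<sigma> \<in> gal L" "\<tau> \<in> gal L" for \<sigma> \<tau> a
    using assms(2) that unfolding torus_action_def by simp
  have e_add: "e (a + b) i = e a i + e b i" if "i \<in> I" for a b i
    using that by (auto simp: I_def e_def w_def act_add gal_inv)
  have "\<sigma> (h ch) = h (act \<sigma> ch)" if \<sigma>: "\<sigma> \<in> gal L" for \<sigma> ch
  proof -
    have "\<sigma> (h ch) = (\<Prod>i\<in>I. \<sigma> (c i) powi e ch i)"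
      unfolding h_def using gal_prod[OF \<sigma>, of I "\<lambda>i. c i powi e ch i"]
      by (simp add: gal_power_int[OF \<sigma>] cL power_int_closed)
    also have "\<dots> = h (act \<sigma> ch)"
      unfolding h_def
    \<comment> \<open>Left translation by \<sigma> permutes the Galois group, and hence the
      factors.\<close>
    proof (rule prod.reindex_bij_witness[where j = "\<lambda>(j, \<tau>). (j, \<sigma> \<circ> \<tau>)"
          and i = "\<lambda>(j, \<tau>). (j, inv_into UNIV \<sigma> \<circ> \<tau>)"])
      fix i assume "i \<in> I"
      then obtain j \<tau> where i: "i = (j, \<tau>)" "\<tau> \<in> gal L" by (auto simp: I_def)
      note bij = gal_bij_UNIV[OF \<sigma>] gal_bij_UNIV[OF i(2)]
      have inv: "inv_into UNIV \<sigma> \<circ> \<sigma> = id" "\<sigma> \<circ> inv_into UNIV \<sigma> = id"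
        using bij by (metis bij_is_inj inv_o_cancel, metis bij_is_surj surj_iff)
      show "(case case i of (j, \<tau>) \<Rightarrow> (j, \<sigma> \<circ> \<tau>) of (j, \<tau>) \<Rightarrow> (j, inv_into UNIV \<sigma> \<circ> \<tau>)) = i"
        by (simp add: i inv flip: comp_assoc)
      show "(case i of (j, \<tau>) \<Rightarrow> (j, \<sigma> \<circ> \<tau>)) \<in> I"
        using i \<sigma> by (simp add: I_def gal_comp)
      show "(case case i of (j, \<tau>) \<Rightarrow> (j, inv_into UNIV \<sigma> \<circ> \<tau>) of (j, \<tau>) \<Rightarrow> (j, \<sigma> \<circ> \<tau>)) = i"
        by (simp add: i inv flip: comp_assoc)
      show "(case i of (j, \<tau>) \<Rightarrow> (j, inv_into UNIV \<sigma> \<circ> \<tau>)) \<in> I"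
        using i \<sigma> by (simp add: I_def gal_comp gal_inv)
      \<comment> \<open>This cancellation matches the exponents: the inverse of the translated
        automorphism undoes the extra action of \<sigma>.\<close>
      have "inv_into UNIV (\<sigma> \<circ> \<tau>) \<circ> \<sigma> = inv_into UNIV \<tau>"
        using bij inv by (simp add: o_inv_distrib comp_assoc)
      then have "e (act \<sigma> ch) (j, \<sigma> \<circ> \<tau>) = e ch i"
        using i \<sigma> by (simp add: e_def act_comp gal_inv gal_comp)
      moreover have "c (j, \<sigma> \<circ> \<tau>) = \<sigma> (c i)"
        using \<theta>L gal_closed[OF i(2) \<theta>L]
        by (simp add: c_def i gal_diff[OF \<sigma>] gal_mult[OF \<sigma>] gal_of_int[OF \<sigma>] gal_one[OF \<sigma>]
            field_closed)
      ultimately show "c (case i of (j, \<tau>) \<Rightarrow> (j, \<sigma> \<circ> \<tau>))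
          powi e (act \<sigma> ch) (case i of (j, \<tau>) \<Rightarrow> (j, \<sigma> \<circ> \<tau>))
          = \<sigma> (c i) powi e ch i" by (simp add: i)
    qed
    finally show ?thesis .
  qed
  moreover have "h ch \<in> L" "h ch \<noteq> 0" for ch
    unfolding h_def using fin cL c0 by (auto intro!: field_closed)
  moreover have "h (a + b) = h a * h b" for a b
    unfolding h_def by (simp add: e_add c0 power_int_add flip: prod.distrib)
  ultimately have "rational_point L act h" unfolding rational_point_def by simp
  moreover have "\<not> alg_int (h ch)" if ch: "ch \<noteq> 0" for ch
  proof
    assume "alg_int (h ch)"
    obtain k where k: "vec_nth ch k \<noteq> 0" using ch
      by (metis Finite_Cartesian_Product.vec_eq_iff Finite_Cartesian_Product.zero_index)
    \<comment> \<open>The sign is chosen to make the form negative on \<open>ch\<close>: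
      \<open>True\<close> gives the coordinate itself, \<open>False\<close> its negative.\<close>
    define j where "j = (k, vec_nth ch k < 0)"
    have "act id = id" using assms(2) by (simp add: torus_action_def)
    then have "e ch (j, id) < 0"
      using k by (simp add: e_def w_def j_def)
    moreover have "(j, id) \<in> I" using gal_id by (simp add: I_def)
    ultimately have "alg_int (1 / c (j, id))"
      using alg_int_inverse_if_prod_power_int[OF fin, of "(j, id)" "e ch" c] cint c0 comax
        \<open>alg_int (h ch)\<close> unfolding h_def by blast
    moreover have "\<not> alg_int (1 / (1 - of_int (s j) * \<theta>))"
      using p(5) c0[OF \<open>(j, id) \<in> I\<close>]
      by (intro one_minus_mult_not_unit[OF p(2) _ s(1,3)]) (auto simp: \<theta>_def c_def)
    ultimately show False by (simp add: c_def)
  qed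
  moreover have "cong_mod_local L \<pi> n (h ch) 1" if \<pi>: "nonzero_prime_ideal L \<pi>" "of_nat n \<in> \<pi>" for ch \<pi>
  proof -
    have c1: "c i \<in> one_mod n" if i: "i \<in> I" for i
    proof -
      obtain j \<sigma> where j: "i = (j, \<sigma>)" "\<sigma> \<in> gal L" using i by (auto simp: I_def)
      obtain q where q: "s j = int n * q" using s(2)[of j] by (metis dvdE mult.assoc)
      have "c i = 1 + of_nat n * (of_int (- q) * \<sigma> \<theta>)" by (simp add: c_def j q)
      moreover have "of_int (- q) * \<sigma> \<theta> \<in> ring_of_integers L"
        unfolding ring_of_integers_def using int[OF j(2)] gal_closed[OF j(2) \<theta>L]
        by (auto intro!: field_closed alg_int_intros)
      ultimately show ?thesis
        unfolding one_mod_def using cL[OF i] cint[OF i] by (auto simp: ring_of_integers_def)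
    qed
    \<comment> \<open>Separating positive from negative exponents presents \<open>h ch\<close> as a
      quotient of two elements congruent to 1 modulo \<open>n\<close>.\<close>
    have "h ch = (\<Prod>i\<in>I. c i ^ nat (e ch i)) / (\<Prod>i\<in>I. c i ^ nat (- e ch i))"
      unfolding h_def power_int_eq_power_divide by (rule prod_dividef)
    then show ?thesis
      using \<pi> fin c0 c1 by (auto intro!: cong_mod_local_divide_one_mod assms(4) one_mod_prod one_mod_power)
  qed
  ultimately show ?thesis by blast
qed

end
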